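(* Let $\widehat{\Xi}=\{\widehat{\xi}_1,\ldots,\widehat{\xi}_T\}$ be a set of observations in $\Xi$, let $\lambda\ge 0$, and let $\sigma:\{1,\ldots,T\}\to\widehat{\Xi}$ be a sequence giving the order in which the observations occur. Assume that for every sequence of pairwise different observations in $\widehat{\Xi}$, the collection of the nonzero distances between consecutive members of the sequence has unique subset sums. Let $1\le s'<s\le T$ and let $\sigma'$ be the sequence obtained from $\sigma$ by moving the observation at time $s$ to the earlier time $s'$ and shifting the observations at times $s',\ldots,s-1$ one period later: $\sigma'(s')=\sigma(s)$, $\sigma'(t)=\sigma(t-1)$ for $t=s'+1,\ldots,s$, and $\sigma'(t)=\sigma(t)$ for all other $t$. If $\sigma(s)=\widehat{\xi}_s$ and each of the observations $\sigma(s'),\sigma(s'+1),\ldots,\sigma(s-1)$ is in a different component to $\widehat{\xi}_s$ in an optimal solution to problem (R) (given in the context) for the sequence $\sigma$, then $$\mathbb{P}^{\star}_T(\{\widehat{\xi}_s\};\sigma)\ \ge\ \mathbb{P}^{\star}_T(\{\widehat{\xi}_s\};\sigma').$$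
   Context: $\Xi$ is a closed subset of $\mathbb{R}^m$ and $d$ is a metric on $\Xi$ such that $(\Xi,d)$ is a Polish metric space and $d$ is lower semicontinuous. $[T]=\{1,\ldots,T\}$. Convention: $\log(0):=-\infty$. A set of scalars $\{c_1,\ldots,c_N\}$ (indexed by $[N]$) has unique subset sums if there are no two subsets $I,I'\subseteq[N]$ with $I\neq I'$ and $\sum_{i\in I}c_i=\sum_{i\in I'}c_i$. Problem (R) for a sequence $\sigma$: put $d_\sigma(i,j):=d(\sigma(i),\sigma(j))$ for $i,j\in[T]$. Over variables $x(i,j)\ge 0$, $i\in\{0\}\cup[T]$, $j\in[T+1]$ (node $0$ is a source and node $T+1$ a sink), $$\text{maximize}\quad\sum_{j=1}^{T}\log\Bigl(\sum_{i=0}^{T}x(i,j)\Bigr)-\lambda\sum_{j=1}^{T}\sum_{i=1}^{T}d_\sigma(i,j)x(i,j)$$ subject to $\sum_{j=1}^{T}x(0,j)=1$; $\sum_{i=0}^{T}x(i,j)=\sum_{k=1}^{T+1}x(j,k)$ for $j\in[T]$; $x(i,j)=0$ for $i\in[T]$, $j\in[i]$; and $x(0,T+1)=0$. Components: a feasible solution $x$ to (R) defines an undirected graph on the nodes $\{1,\ldots,T\}$ in which $i,j$ are joined when $x(i,j)>0$ or $x(j,i)>0$; a component in $x$ is a connected component of this graph. Two observations $\sigma(i)$ and $\sigma(j)$ are in different components if the nodes $i$ and $j$ are. Terminal probabilities: under the unique-subset-sum assumption, the values $x(i,T+1)$, $i\in[T]$, are the same for every optimal solution $x$ to (R) for $\sigma$.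 $\mathbb{P}^{\star}_T(\{\widehat{\xi}\};\sigma)$ denotes this value $x(i,T+1)$ for the index $i$ with $\sigma(i)=\widehat{\xi}$, i.e. the optimal terminal probability assigned to observation $\widehat{\xi}$ under the sequence $\sigma$ (and similarly for $\sigma'$, with (R) formed using $\sigma'$). *)

theory Defs
  imports "HOL-Analysis.Analysis"
begin

definition lower_semicontinuous_on :: "'a::topological_space set \<Rightarrow> ('a \<Rightarrow> real) \<Rightarrow> bool" where
  "lower_semicontinuous_on S f \<longleftrightarrow>
     (\<forall>p\<in>S. \<forall>c<f p. eventually (\<lambda>q. c < f q) (at p within S))"

(* Lower semicontinuity refers to the Euclidean topology of Xi x Xi, whereas completeness and
   separability refer to the metric d. *)
definition lsc_polish_metric :: "('a::topological_space) set \<Rightarrow> ('a \<Rightarrow> 'a \<Rightarrow> real) \<Rightarrow> bool" where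
  "lsc_polish_metric Xi d \<longleftrightarrow>
     Metric_space Xi d \<and>
     Metric_space.mcomplete Xi d \<and>
     separable_space (Metric_space.mtopology Xi d) \<and>
     lower_semicontinuous_on (Xi \<times> Xi) (\<lambda>(u, v). d u v)"

(* A family of scalars: subsets of the index set are compared, so equal scalars at different
   indices violate the property. *)
definition unique_subset_sums :: "'i set \<Rightarrow> ('i \<Rightarrow> real) \<Rightarrow> bool" where
  "unique_subset_sums A c \<longleftrightarrow>
     \<not> (\<exists>I I'. I \<subseteq> A \<and> I' \<subseteq> A \<and> I \<noteq> I' \<and> (\<Sum>i\<in>I. c i) = (\<Sum>i\<in>I'. c i))"

definition consecutive_dists_unique_sums :: "('a \<Rightarrow> 'a \<Rightarrow> real) \<Rightarrow> 'a set \<Rightarrow> bool" where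
  "consecutive_dists_unique_sums d Obs \<longleftrightarrow>
     (\<forall>xs. distinct xs \<and> set xs \<subseteq> Obs \<longrightarrow>
        unique_subset_sums
          {k. Suc k < length xs \<and> d (xs ! k) (xs ! Suc k) \<noteq> 0}
          (\<lambda>k. d (xs ! k) (xs ! Suc k)))"

(* The logarithm with log 0 = -\<infinity>; the library function satisfies ln 0 = 0 on the reals. *)
definition log_ext :: "real \<Rightarrow> ereal" where
  "log_ext y = (if y > 0 then ereal (ln y) else -\<infinity>)"

(* Node 0 is the source and node T + 1 the sink; x i j matters only for i in {0..T} and
   j in {1..T+1}. *)
definition feasible :: "nat \<Rightarrow> (nat \<Rightarrow> nat \<Rightarrow> real) \<Rightarrow> bool" where
  "feasible T x \<longleftrightarrow>
     (\<forall>i\<in>{0..T}. \<forall>j\<in>{1..T+1}. x i j \<ge> 0) \<and>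
     (\<Sum>j=1..T. x 0 j) = 1 \<and>
     (\<forall>j\<in>{1..T}. (\<Sum>i=0..T. x i j) = (\<Sum>k=1..T+1. x j k)) \<and>
     (\<forall>i\<in>{1..T}. \<forall>j\<in>{1..i}. x i j = 0) \<and>
     x 0 (T+1) = 0"

definition objective ::
  "('a \<Rightarrow> 'a \<Rightarrow> real) \<Rightarrow> real \<Rightarrow> nat \<Rightarrow> (nat \<Rightarrow> 'a) \<Rightarrow> (nat \<Rightarrow> nat \<Rightarrow> real) \<Rightarrow> ereal" where
  "objective d lam T \<sigma> x =
     (\<Sum>j=1..T. log_ext (\<Sum>i=0..T. x i j))
       - ereal (lam * (\<Sum>j=1..T. \<Sum>i=1..T. d (\<sigma> i) (\<sigma> j) * x i j))"

definition optimal ::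
  "('a \<Rightarrow> 'a \<Rightarrow> real) \<Rightarrow> real \<Rightarrow> nat \<Rightarrow> (nat \<Rightarrow> 'a) \<Rightarrow> (nat \<Rightarrow> nat \<Rightarrow> real) \<Rightarrow> bool" where
  "optimal d lam T \<sigma> x \<longleftrightarrow>
     feasible T x \<and> (\<forall>y. feasible T y \<longrightarrow> objective d lam T \<sigma> y \<le> objective d lam T \<sigma> x)"

definition joined :: "nat \<Rightarrow> (nat \<Rightarrow> nat \<Rightarrow> real) \<Rightarrow> (nat \<times> nat) set" where
  "joined T x = {(i, j). i \<in> {1..T} \<and> j \<in> {1..T} \<and> (x i j > 0 \<or> x j i > 0)}"

definition same_component :: "nat \<Rightarrow> (nat \<Rightarrow> nat \<Rightarrow> real) \<Rightarrow> nat \<Rightarrow> nat \<Rightarrow> bool" where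
  "same_component T x i j \<longleftrightarrow> (i, j) \<in> (joined T x)\<^sup>*"

definition terminal_values ::
  "('a \<Rightarrow> 'a \<Rightarrow> real) \<Rightarrow> real \<Rightarrow> nat \<Rightarrow> (nat \<Rightarrow> 'a) \<Rightarrow> 'a \<Rightarrow> real set" where
  "terminal_values d lam T \<sigma> \<xi> =
     {x (THE i. i \<in> {1..T} \<and> \<sigma> i = \<xi>) (T+1) | x. optimal d lam T \<sigma> x}"

(* The terminal probability is the value common to all optimal solutions. Consecutive distances
   along sequences of distinct points constrain sums over paths only, and there are instances with
   unique subset sums in that sense whose optimal solutions do not share a terminal value. The
   second branch makes the function total there: it takes the largest optimal value. *)
definition terminal_prob ::
  "('a \<Rightarrow> 'a \<Rightarrow> real) \<Rightarrow> real \<Rightarrow> nat \<Rightarrow> (nat \<Rightarrow> 'a) \<Rightarrow> 'a \<Rightarrow> real" where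
  "terminal_prob d lam T \<sigma> \<xi> =
     (if \<exists>!p. p \<in> terminal_values d lam T \<sigma> \<xi>
      then THE p. p \<in> terminal_values d lam T \<sigma> \<xi>
      else Sup (terminal_values d lam T \<sigma> \<xi>))"

definition move_earlier :: "nat \<Rightarrow> nat \<Rightarrow> (nat \<Rightarrow> 'a) \<Rightarrow> nat \<Rightarrow> 'a" where
  "move_earlier s' s \<sigma> t =
     (if t = s' then \<sigma> s else if s' < t \<and> t \<le> s then \<sigma> (t - 1) else \<sigma> t)"

end

theory Submission
  imports Defs
begin

text \<open>
  Up to relabelling, problem (R) for \<open>\<sigma>'\<close> differs from problem (R) for \<open>\<sigma>\<close> by deleting the
  arcs from the block \<open>s', \<dots>, s - 1\<close> into \<open>s\<close>, and by adding the arcs from \<open>s\<close> into the block.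
  The deletion is harmless, because the given optimal solution \<open>x\<close> carries no flow on the deleted
  arcs. The added arcs all leave \<open>s\<close>, like the terminal arc \<open>(s, T + 1)\<close>, and in a separable concave
  flow problem arcs leaving a common node are substitutes: a solution \<open>x'\<close> of the larger problem
  with more terminal flow at \<open>s\<close> differs from \<open>x\<close> by a circulation, whose part carrying the
  terminal arc consists of cycles that leave \<open>s\<close> only through that arc. Moving this part \<open>z\<close> from
  \<open>x'\<close> to \<open>x\<close> yields feasible \<open>x + z\<close> and \<open>x' - z\<close>, and by concavity \<open>x + z\<close> is again optimal for
  \<open>\<sigma>\<close>. So every terminal value of \<open>\<sigma>'\<close> is dominated by one of \<open>\<sigma>\<close>.
\<close>

section \<open>Conformal parts of circulations\<close>

definition circulation :: "'v set \<Rightarrow> ('v \<Rightarrow> 'v \<Rightarrow> real) \<Rightarrow> bool" where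
  "circulation V y \<longleftrightarrow> (\<forall>v\<in>V. (\<Sum>u\<in>V. y v u) = (\<Sum>u\<in>V. y u v))"

text \<open>If \<open>z\<close> is conformal to \<open>x' - x\<close>, then \<open>x + z\<close> and
  \<open>x' - z\<close> both lie between \<open>x\<close> and \<open>x'\<close>. This one property
  yields nonnegativity, support on the right arcs, and the concavity estimate.\<close>

definition conformal :: "real \<Rightarrow> real \<Rightarrow> bool" where
  "conformal z y \<longleftrightarrow> (0 \<le> z \<and> z \<le> y) \<or> (y \<le> z \<and> z \<le> 0)"

lemma circulation_add:
  "circulation V y \<Longrightarrow> circulation V z \<Longrightarrow> circulation V (\<lambda>u v. y u v + z u v)"
  by (simp add: circulation_def sum.distrib)

lemma circulation_diff:
  "circulation V y \<Longrightarrow> circulation V z \<Longrightarrow> circulation V (\<lambda>u v. y u v - z u v)"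
  by (simp add: circulation_def sum_subtractf)

lemma circulation_scale: "circulation V y \<Longrightarrow> circulation V (\<lambda>u v. c * y u v)"
  by (simp add: circulation_def flip: sum_distrib_left)

text \<open>
  The pairs \<open>(u, v)\<close> are the residual arcs of \<open>y\<close>; those leaving \<open>a\<close> are excluded, so that the path
  flow avoids all arcs \<open>(a, v)\<close> with \<open>y a v > 0\<close>.
\<close>

lemma residual_path_flow:
  fixes y :: "'v \<Rightarrow> 'v \<Rightarrow> real"
  assumes "finite V"
    and "(b, c) \<in> {(u, v). u \<in> V \<and> v \<in> V \<and> u \<noteq> a \<and> (y u v > 0 \<or> y v u < 0)}\<^sup>*"
  shows "\<exists>z::'v \<Rightarrow> 'v \<Rightarrow> real. (\<forall>v\<in>V. (\<Sum>u\<in>V. z v u) - (\<Sum>u\<in>V. z u v) = of_bool (v = b) - of_bool (v = c)) \<and>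
             (\<forall>u v. (z u v > 0 \<longrightarrow> y u v > 0) \<and> (z u v < 0 \<longrightarrow> y u v < 0)) \<and>
             (\<forall>v. y a v > 0 \<longrightarrow> z a v = 0)"
  using assms(2)
proof (induction rule: rtrancl_induct)
  case base
  show ?case by (rule exI[of _ "\<lambda>_ _. 0"]) auto
next
  case (step c c')
  from step.IH obtain z :: "'v \<Rightarrow> 'v \<Rightarrow> real" where z:
    "\<And>v. v \<in> V \<Longrightarrow> (\<Sum>u\<in>V. z v u) - (\<Sum>u\<in>V. z u v) = of_bool (v = b) - of_bool (v = c)"
    "\<And>u v. z u v > 0 \<Longrightarrow> y u v > 0" "\<And>u v. z u v < 0 \<Longrightarrow> y u v < 0"
    "\<And>v. y a v > 0 \<Longrightarrow> z a v = 0" by blast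
  from step(2) have V: "c \<in> V" "c' \<in> V" "c \<noteq> a" and "y c c' > 0 \<or> y c' c < 0" by auto
  \<comment> \<open>Unit flow on one arc. It is added along a residual arc with
    \<open>y c c' > 0\<close>, and subtracted on the reversed arc when
    \<open>y c' c < 0\<close>.\<close>
  define unit :: "'v \<Rightarrow> 'v \<Rightarrow> 'v \<Rightarrow> 'v \<Rightarrow> real"
    where "unit p q u v = (if u = p \<and> v = q then 1 else 0)" for p q u v
  have row: "(\<Sum>u\<in>V. unit p q v u) = of_bool (v = p)" if "q \<in> V" for p q v
    using that assms(1) by (cases "v = p") (simp_all add: unit_def)
  have col: "(\<Sum>u\<in>V. unit p q u v) = of_bool (v = q)" if "p \<in> V" for p q v
    using that assms(1) by (cases "v = q") (simp_all add: unit_def)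
  from \<open>y c c' > 0 \<or> y c' c < 0\<close> show ?case
  proof
    assume pos: "y c c' > 0"
    have "(\<Sum>u\<in>V. z v u + unit c c' v u) - (\<Sum>u\<in>V. z u v + unit c c' u v)
        = of_bool (v = b) - of_bool (v = c')" if "v \<in> V" for v
      using z(1)[OF that] V by (simp add: sum.distrib row col)
    moreover have "(z u v + unit c c' u v > 0 \<longrightarrow> y u v > 0) \<and>
        (z u v + unit c c' u v < 0 \<longrightarrow> y u v < 0)" for u v
      using z(2,3)[of u v] pos by (auto simp: unit_def)
    moreover have "z a v + unit c c' a v = 0" if "y a v > 0" for v
      using z(4)[OF that] V by (simp add: unit_def)
    ultimately show ?thesis by (intro exI[of _ "\<lambda>u v. z u v + unit c c' u v"]) blast
  next
    assume neg: "y c' c < 0"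
    have "(\<Sum>u\<in>V. z v u - unit c' c v u) - (\<Sum>u\<in>V. z u v - unit c' c u v)
        = of_bool (v = b) - of_bool (v = c')" if "v \<in> V" for v
      using z(1)[OF that] V by (simp add: sum_subtractf row col)
    moreover have "(z u v - unit c' c u v > 0 \<longrightarrow> y u v > 0) \<and>
        (z u v - unit c' c u v < 0 \<longrightarrow> y u v < 0)" for u v
      using z(2,3)[of u v] neg by (auto simp: unit_def)
    \<comment> \<open>If \<open>c' = a\<close>, row \<open>a\<close> does change, but only at
      \<open>(a, c)\<close>, where \<open>y\<close> is negative.\<close>
    moreover have "z a v - unit c' c a v = 0" if "y a v > 0" for v
      using z(4)[OF that] neg that by (auto simp: unit_def)
    ultimately show ?thesis by (intro exI[of _ "\<lambda>u v. z u v - unit c' c u v"]) blast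
  qed
qed

text \<open>A residual path from \<open>b\<close> back to \<open>a\<close> is closed by the arc
  \<open>(a, b)\<close>. If there were none, the set reachable from \<open>b\<close> would have no
  positive net flow out, yet positive flow in through \<open>(a, b)\<close>, against
  conservation.\<close>

lemma residual_cycle:
  fixes y :: "'v \<Rightarrow> 'v \<Rightarrow> real"
  assumes fin: "finite V" and circ: "circulation V y"
    and ab: "a \<in> V" "b \<in> V" "y a b > 0"
  obtains z where "circulation V z" "z a b > 0"
    "\<And>u v. z u v > 0 \<Longrightarrow> y u v > 0" "\<And>u v. z u v < 0 \<Longrightarrow> y u v < 0"
    "\<And>v. v \<noteq> b \<Longrightarrow> y a v > 0 \<Longrightarrow> z a v = 0"
proof -
  define D where "D = {(u, v). u \<in> V \<and> v \<in> V \<and> u \<noteq> a \<and> (y u v > 0 \<or> y v u < 0)}"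
  have "(b, a) \<in> D\<^sup>*"
  proof (rule ccontr)
    assume "(b, a) \<notin> D\<^sup>*"
    define R where "R = {v \<in> V. (b, v) \<in> D\<^sup>*}"
    have R: "finite R" "R \<subseteq> V" "b \<in> R" "a \<notin> R"
      using fin ab \<open>(b, a) \<notin> D\<^sup>*\<close> by (auto simp: R_def)
    have closed: "v \<in> R" if "u \<in> R" "v \<in> V" "y u v > 0 \<or> y v u < 0" for u v
    proof -
      \<comment> \<open>Excluding the arcs that leave \<open>a\<close> is harmless for reachability,
        since \<open>a\<close> is not in \<open>R\<close>.\<close>
      have "(u, v) \<in> D" using that R by (auto simp: D_def)
      then show ?thesis using that by (auto simp: R_def intro: rtrancl_into_rtrancl)
    qed
    \<comment> \<open>Summing conservation over \<open>R\<close> cancels the arcs inside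
      \<open>R\<close> and leaves the balance across the cut.\<close>
    have "(\<Sum>v\<in>R. \<Sum>u\<in>V. y v u) = (\<Sum>v\<in>R. \<Sum>u\<in>V. y u v)"
      using circ R by (intro sum.cong[OF refl, of R]) (unfold circulation_def, blast)
    moreover have "(\<Sum>u\<in>V. f u) = (\<Sum>u\<in>R. f u) + (\<Sum>u\<in>V-R. f u)" for f :: "'v \<Rightarrow> real"
      using sum.subset_diff[OF R(2) fin, of f] by simp
    moreover have "(\<Sum>v\<in>R. \<Sum>u\<in>R. y v u) = (\<Sum>v\<in>R. \<Sum>u\<in>R. y u v)"
      by (rule sum.swap)
    ultimately have "(\<Sum>v\<in>R. \<Sum>u\<in>V-R. y v u) = (\<Sum>v\<in>R. \<Sum>u\<in>V-R. y u v)"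
      by (simp add: sum.distrib)
    moreover have "(\<Sum>v\<in>R. \<Sum>u\<in>V-R. y v u) \<le> 0"
    proof (intro sum_nonpos)
      show "y v u \<le> 0" if "v \<in> R" "u \<in> V - R" for v u
        using closed[of v u] that by force
    qed
    moreover have "(\<Sum>v\<in>R. \<Sum>u\<in>V-R. y u v) > 0"
    proof (rule sum_pos2[OF R(1,3)])
      have nn: "y u v \<ge> 0" if "v \<in> R" "u \<in> V - R" for u v
        using closed[of v u] that by force
      show "(\<Sum>u\<in>V-R. y u b) > 0"
        using ab R fin nn by (intro sum_pos2[of _ a]) auto
      show "0 \<le> (\<Sum>u\<in>V-R. y u v)" if "v \<in> R" for v
        using nn that by (intro sum_nonneg) auto
    qed
    ultimately show False by linarith
  qed
  then obtain z :: "'v \<Rightarrow> 'v \<Rightarrow> real" where z: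
    "\<And>v. v \<in> V \<Longrightarrow> (\<Sum>u\<in>V. z v u) - (\<Sum>u\<in>V. z u v) = of_bool (v = b) - of_bool (v = a)"
    "\<And>u v. z u v > 0 \<Longrightarrow> y u v > 0" "\<And>u v. z u v < 0 \<Longrightarrow> y u v < 0"
    "\<And>v. y a v > 0 \<Longrightarrow> z a v = 0"
    using residual_path_flow[OF fin, of b a a y] unfolding D_def by blast
  \<comment> \<open>The path carries nothing on \<open>(a, b)\<close>, so the closing arc ends up
    with value 1.\<close>
  define w where "w u v = z u v + (if u = a \<and> v = b then 1 else 0)" for u v
  have "(\<Sum>u\<in>V. w v u) = (\<Sum>u\<in>V. z v u) + of_bool (v = a)" for v
    using ab fin by (cases "v = a") (simp_all add: w_def sum.distrib)
  moreover have "(\<Sum>u\<in>V. w u v) = (\<Sum>u\<in>V. z u v) + of_bool (v = b)" for v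
    using ab fin by (cases "v = b") (simp_all add: w_def sum.distrib)
  ultimately have "circulation V w" using z(1) by (force simp: circulation_def algebra_simps)
  moreover have "w a b > 0" using z(4)[OF ab(3)] by (simp add: w_def)
  moreover have "y u v > 0" if "w u v > 0" for u v
    using z(2)[of u v] that ab by (auto simp: w_def split: if_splits)
  moreover have "y u v < 0" if "w u v < 0" for u v
    using z(3)[of u v] that by (auto simp: w_def split: if_splits)
  moreover have "w a v = 0" if "v \<noteq> b" "y a v > 0" for v
    using z(4)[of v] that by (simp add: w_def)
  ultimately show ?thesis using that by blast
qed

text \<open>Residual cycles through \<open>(a, b)\<close> are peeled off until that entry is
  exhausted. Each one is scaled so that some nonzero entry vanishes, hence the induction on the size
  of the support.\<close>

lemma conformal_subcirculation:
  fixes y :: "'v \<Rightarrow> 'v \<Rightarrow> real"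
  assumes "finite V" "circulation V y" "a \<in> V" "b \<in> V" "y a b \<ge> 0"
  shows "\<exists>z. circulation V z \<and> z a b = y a b \<and> (\<forall>u\<in>V. \<forall>v\<in>V. conformal (z u v) (y u v)) \<and>
             (\<forall>v\<in>V. v \<noteq> b \<longrightarrow> y a v > 0 \<longrightarrow> z a v = 0)"
  using assms(2,5)
proof (induction "card {(u, v) \<in> V \<times> V. y u v \<noteq> 0}" arbitrary: y rule: less_induct)
  case less
  show ?case
  proof (cases "y a b = 0")
    case True
    then show ?thesis
      by (intro exI[of _ "\<lambda>_ _. 0"]) (auto simp: circulation_def conformal_def)
  next
    case False
    with less.prems have "y a b > 0" by simp
    then obtain z where z: "circulation V z" "z a b > 0"
      "\<And>u v. z u v > 0 \<Longrightarrow> y u v > 0" "\<And>u v. z u v < 0 \<Longrightarrow> y u v < 0"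
      "\<And>v. v \<noteq> b \<Longrightarrow> y a v > 0 \<Longrightarrow> z a v = 0"
      using residual_cycle[OF assms(1) less.prems(1) assms(3,4)] by metis
    define S where "S = {(u, v) \<in> V \<times> V. z u v \<noteq> 0}"
    define r where "r = (\<lambda>(u, v). y u v / z u v)"
    \<comment> \<open>The largest multiple of \<open>z\<close> that is still conformal to
      \<open>y\<close>. All ratios are positive because \<open>z\<close> has the signs of
      \<open>y\<close> on its support.\<close>
    define \<epsilon> where "\<epsilon> = Min (r ` S)"
    have S: "finite S" "(a, b) \<in> S"
      using assms z(2) by (auto simp: S_def intro: finite_subset[of _ "V \<times> V"])
    have "\<epsilon> \<in> r ` S" unfolding \<epsilon>_def using S by (intro Min_in) auto
    then obtain p q where pq: "(p, q) \<in> S" "\<epsilon> = y p q / z p q" by (auto simp: r_def)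
    then have "\<epsilon> > 0"
      using z(3,4)[of p q] by (auto simp: S_def zero_less_divide_iff linorder_neq_iff)
    have le: "\<epsilon> \<le> y u v / z u v" if "u \<in> V" "v \<in> V" "z u v \<noteq> 0" for u v
      unfolding \<epsilon>_def using that S by (intro Min_le) (auto simp: S_def r_def image_iff)
    have conf: "conformal (\<epsilon> * z u v) (y u v)" if "u \<in> V" "v \<in> V" for u v
    proof -
      consider "z u v = 0" | "z u v > 0" | "z u v < 0" by linarith
      then show ?thesis
      proof cases
        case 1 then show ?thesis by (auto simp: conformal_def)
      next
        case 2
        with le[OF that] \<open>\<epsilon> > 0\<close> show ?thesis by (auto simp: conformal_def field_simps)
      next
        case 3
        with le[OF that] \<open>\<epsilon> > 0\<close> show ?thesis
          by (auto simp: conformal_def field_simps mult_le_0_iff)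
      qed
    qed
    define y' where "y' u v = y u v - \<epsilon> * z u v" for u v
    have sub: "conformal (y' u v) (y u v)" if "u \<in> V" "v \<in> V" for u v
      using conf[OF that] by (auto simp: conformal_def y'_def)
    have circ': "circulation V y'"
      unfolding y'_def by (intro circulation_diff circulation_scale less.prems z)
    have "y' p q = 0" "y p q \<noteq> 0" "p \<in> V" "q \<in> V"
      using pq \<open>\<epsilon> > 0\<close> by (auto simp: y'_def S_def)
    then have "{(u, v) \<in> V \<times> V. y' u v \<noteq> 0} \<subset> {(u, v) \<in> V \<times> V. y u v \<noteq> 0}"
      using sub by (fastforce simp: conformal_def)
    then have "card {(u, v) \<in> V \<times> V. y' u v \<noteq> 0} < card {(u, v) \<in> V \<times> V. y u v \<noteq> 0}"
      using assms(1) by (intro psubset_card_mono) (auto intro: finite_subset[of _ "V \<times> V"])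
    moreover have "y' a b \<ge> 0" using sub[OF assms(3,4)] less.prems by (auto simp: conformal_def)
    ultimately obtain z' where z': "circulation V z'" "z' a b = y' a b"
      "\<forall>u\<in>V. \<forall>v\<in>V. conformal (z' u v) (y' u v)"
      "\<forall>v\<in>V. v \<noteq> b \<longrightarrow> y' a v > 0 \<longrightarrow> z' a v = 0"
      using less.hyps[of y'] circ' by blast
    have "circulation V (\<lambda>u v. \<epsilon> * z u v + z' u v)"
      by (intro circulation_add circulation_scale z z')
    moreover have "conformal (\<epsilon> * z u v + z' u v) (y u v)" if "u \<in> V" "v \<in> V" for u v
      using conf[OF that] z'(3)[rule_format, OF that] by (auto simp: conformal_def y'_def)
    \<comment> \<open>The cycle leaves such an entry unchanged, so it is still positive in
      \<open>y'\<close> and the induction hypothesis covers it.\<close>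
    moreover have "\<epsilon> * z a v + z' a v = 0" if "v \<in> V" "v \<noteq> b" "y a v > 0" for v
      using z(5)[of v] z'(4) that by (simp add: y'_def)
    ultimately show ?thesis
      using z'(2) by (intro exI[of _ "\<lambda>u v. \<epsilon> * z u v + z' u v"]) (simp add: y'_def)
  qed
qed

section \<open>Flows and their payoffs\<close>

text \<open>The arc set is a parameter because, in the labels of \<open>\<sigma>\<close>, the arcs
  permitted by \<open>\<sigma>'\<close> are no longer those with \<open>i < j\<close>.\<close>

definition flow_on :: "(nat \<times> nat) set \<Rightarrow> nat \<Rightarrow> (nat \<Rightarrow> nat \<Rightarrow> real) \<Rightarrow> bool" where
  "flow_on A T x \<longleftrightarrow>
     (\<forall>i\<in>{0..T}. \<forall>j\<in>{1..T+1}. x i j \<ge> 0) \<and>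
     (\<Sum>j=1..T. x 0 j) = 1 \<and>
     (\<forall>j\<in>{1..T}. (\<Sum>i=0..T. x i j) = (\<Sum>k=1..T+1. x j k)) \<and>
     (\<forall>i\<in>{1..T}. \<forall>j\<in>{1..T}. (i, j) \<notin> A \<longrightarrow> x i j = 0) \<and>
     x 0 (T+1) = 0"

lemma feasible_eq_flow_on: "feasible T x \<longleftrightarrow> flow_on {(i, j). i < j} T x"
  by (fastforce simp: feasible_def flow_on_def not_less)

text \<open>
  The exponential of the objective, which turns the value \<open>-\<infinity>\<close> into \<open>0\<close>.
\<close>

definition payoff ::
  "('a \<Rightarrow> 'a \<Rightarrow> real) \<Rightarrow> real \<Rightarrow> nat \<Rightarrow> (nat \<Rightarrow> 'a) \<Rightarrow> (nat \<Rightarrow> nat \<Rightarrow> real) \<Rightarrow> real" where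
  "payoff d lam T \<sigma> x =
     (\<Prod>j=1..T. \<Sum>i=0..T. x i j) * exp (- (lam * (\<Sum>j=1..T. \<Sum>i=1..T. d (\<sigma> i) (\<sigma> j) * x i j)))"

lemma log_ext_mult: "a \<ge> 0 \<Longrightarrow> b \<ge> 0 \<Longrightarrow> log_ext (a * b) = log_ext a + log_ext b"
  by (auto simp: log_ext_def zero_less_mult_iff ln_mult)

lemma sum_log_ext:
  assumes "finite A" "\<And>j. j \<in> A \<Longrightarrow> f j \<ge> 0"
  shows "(\<Sum>j\<in>A. log_ext (f j)) = log_ext (\<Prod>j\<in>A. f j)"
  using assms
proof (induction A rule: finite_induct)
  case empty
  show ?case by (simp add: log_ext_def zero_ereal_def)
next
  case (insert a A)
  then have "f a \<ge> 0" "(\<Prod>j\<in>A. f j) \<ge> 0" by (auto intro: prod_nonneg)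
  with insert show ?case
    by (simp add: log_ext_mult)
qed

lemma flow_on_nonneg:
  "flow_on A T x \<Longrightarrow> i \<in> {0..T} \<Longrightarrow> j \<in> {1..T+1} \<Longrightarrow> x i j \<ge> 0"
  by (simp add: flow_on_def)

lemma flow_on_zero:
  "flow_on A T x \<Longrightarrow> i \<in> {1..T} \<Longrightarrow> j \<in> {1..T} \<Longrightarrow> (i, j) \<notin> A \<Longrightarrow> x i j = 0"
  by (simp add: flow_on_def)

lemma flow_on_change_arcs:
  assumes "flow_on A T x"
    and "\<And>i j. i \<in> {1..T} \<Longrightarrow> j \<in> {1..T} \<Longrightarrow> (i, j) \<in> A \<Longrightarrow> (i, j) \<notin> B \<Longrightarrow> x i j = 0"
  shows "flow_on B T x"
proof -
  have "x i j = 0" if "i \<in> {1..T}" "j \<in> {1..T}" "(i, j) \<notin> B" for i j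
    using flow_on_zero[OF assms(1) that(1,2)] assms(2)[OF that(1,2) _ that(3)] by blast
  then show ?thesis using assms(1) by (simp add: flow_on_def)
qed

lemma throughput_nonneg:
  "flow_on A T x \<Longrightarrow> j \<in> {1..T+1} \<Longrightarrow> (\<Sum>i=0..T. x i j) \<ge> 0"
  by (intro sum_nonneg flow_on_nonneg)

lemma payoff_nonneg: "flow_on A T x \<Longrightarrow> payoff d lam T \<sigma> x \<ge> 0"
  unfolding payoff_def by (intro mult_nonneg_nonneg prod_nonneg throughput_nonneg) auto

lemma objective_eq_log_payoff:
  assumes "flow_on A T x"
  shows "objective d lam T \<sigma> x = log_ext (payoff d lam T \<sigma> x)"
proof -
  have "(\<Prod>j=1..T. \<Sum>i=0..T. x i j) \<ge> 0"
    using assms by (intro prod_nonneg throughput_nonneg) auto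
  moreover have "(\<Sum>j=1..T. log_ext (\<Sum>i=0..T. x i j)) = log_ext (\<Prod>j=1..T. \<Sum>i=0..T. x i j)"
    using throughput_nonneg[OF assms] by (intro sum_log_ext) auto
  ultimately show ?thesis
    by (simp add: objective_def payoff_def log_ext_mult) (simp add: log_ext_def minus_ereal_def)
qed

lemma log_ext_le_iff: "a \<ge> 0 \<Longrightarrow> b \<ge> 0 \<Longrightarrow> log_ext a \<le> log_ext b \<longleftrightarrow> a \<le> b"
  by (auto simp: log_ext_def)

text \<open>\<open>log_ext\<close> is strictly increasing on the nonnegative reals. The payoff is
  real-valued and continuous, which serves the compactness argument and lets a positive payoff be
  cancelled from a product.\<close>

lemma optimal_iff_payoff:
  "optimal d lam T \<sigma> x \<longleftrightarrow>
     feasible T x \<and> (\<forall>y. feasible T y \<longrightarrow> payoff d lam T \<sigma> y \<le> payoff d lam T \<sigma> x)"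
  unfolding optimal_def feasible_eq_flow_on
  by (auto simp: objective_eq_log_payoff log_ext_le_iff payoff_nonneg)

lemma feasible_positive_payoff:
  assumes "T \<ge> 1"
  obtains x where "feasible T x" "payoff d lam T \<sigma> x > 0"
proof -
  \<comment> \<open>Each observation gets \<open>1 / T\<close> from the source and passes it
    straight to the sink. The exclusive or rules out the arc from source to sink and all arcs
    between observations.\<close>
  define x :: "nat \<Rightarrow> nat \<Rightarrow> real"
    where "x i j = (if (i = 0) \<noteq> (j = T + 1) then 1 / T else 0)" for i j
  have col: "(\<Sum>i=0..T. x i j) = 1 / T" if "j \<in> {1..T}" for j
  proof -
    have "(\<Sum>i=0..T. x i j) = (\<Sum>i=0..T. if i = 0 then 1 / T else 0)"
      using that by (intro sum.cong) (auto simp: x_def)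
    then show ?thesis by simp
  qed
  have row: "(\<Sum>k=1..T+1. x j k) = 1 / T" if "j \<in> {1..T}" for j
  proof -
    have "(\<Sum>k=1..T+1. x j k) = (\<Sum>k=1..T+1. if k = T + 1 then 1 / T else 0)"
      using that by (intro sum.cong) (auto simp: x_def)
    then show ?thesis by simp
  qed
  have "(\<Sum>j=1..T. x 0 j) = 1"
    using assms by (simp add: x_def)
  then have "feasible T x"
    unfolding feasible_def using col row by (auto simp: x_def)
  moreover have "payoff d lam T \<sigma> x > 0"
    unfolding payoff_def using col assms by (intro mult_pos_pos prod_pos) auto
  ultimately show ?thesis using that by blast
qed

section \<open>Exchanging flow between two solutions\<close>

text \<open>
  Node \<open>i\<close> is split into \<open>Inr i\<close>, where its arcs enter, and \<open>Inl i\<close>, where they leave, joined by an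
  arc that carries the throughput. Hence throughputs change conformally as well, and a cycle
  that leaves \<open>Inl a\<close> leaves it only once.
\<close>

lemma circulation_of_flow_difference:
  fixes y :: "nat \<Rightarrow> nat \<Rightarrow> real"
  assumes "(\<Sum>j=1..T+1. y 0 j) = 0"
    and "\<And>j. j \<in> {1..T} \<Longrightarrow> (\<Sum>i=0..T. y i j) = (\<Sum>k=1..T+1. y j k)"
    and "a \<in> {0..T}" "b \<in> {1..T+1}" "y a b \<ge> 0"
  obtains z where "(\<Sum>j=1..T+1. z 0 j) = 0"
    and "\<And>j. j \<in> {1..T} \<Longrightarrow> (\<Sum>i=0..T. z i j) = (\<Sum>k=1..T+1. z j k)"
    and "z a b = y a b"
    and "\<And>i j. i \<in> {0..T} \<Longrightarrow> j \<in> {1..T+1} \<Longrightarrow> conformal (z i j) (y i j)"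
    and "\<And>j. j \<in> {1..T} \<Longrightarrow> conformal (\<Sum>i=0..T. z i j) (\<Sum>i=0..T. y i j)"
    and "\<And>j. j \<in> {1..T+1} \<Longrightarrow> j \<noteq> b \<Longrightarrow> y a j > 0 \<Longrightarrow> z a j = 0"
proof -
  define row where "row i = (\<Sum>j=1..T+1. y i j)" for i
  define col where "col j = (\<Sum>i=0..T. y i j)" for j
  \<comment> \<open>Balance at the source and at the inner nodes forces balance at the sink, so no
    return arc from sink to source is required.\<close>
  have "(\<Sum>i=0..T. row i) = (\<Sum>j=1..T+1. col j)"
    unfolding row_def col_def by (rule sum.swap)
  moreover have "(\<Sum>i=0..T. row i) = row 0 + (\<Sum>i=1..T. row i)"
    by (simp add: sum.atLeast_Suc_atMost)
  moreover have "(\<Sum>i=1..T. row i) = (\<Sum>j=1..T. col j)"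
    by (rule sum.cong[OF refl]) (use assms(2) in \<open>simp add: row_def col_def\<close>)
  ultimately have "col (T+1) = 0"
    using assms(1) by (simp add: row_def)
  then have sink: "(\<Sum>i=0..T. y i (T+1)) = 0" by (simp add: col_def)
  \<comment> \<open>The source has only a leaving copy, the sink only an entering one.\<close>
  define V :: "(nat + nat) set" where "V = {0..T} <+> {1..T+1}"
  have mem: "Inl i \<in> V \<longleftrightarrow> i \<in> {0..T}" "Inr j \<in> V \<longleftrightarrow> j \<in> {1..T+1}" for i j
    by (auto simp: V_def)
  have sumV: "(\<Sum>v\<in>V. f v) = (\<Sum>i=0..T. f (Inl i)) + (\<Sum>j=1..T+1. f (Inr j))"
    for f :: "nat + nat \<Rightarrow> real"
    unfolding V_def by (subst sum.Plus) auto
  define Y where "Y u v =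
     (case (u, v) of (Inl i, Inr j) \<Rightarrow> y i j
        | (Inr j, Inl i) \<Rightarrow> if i = j \<and> j \<in> {1..T} then \<Sum>k=0..T. y k j else 0
        | _ \<Rightarrow> 0)" for u v
  have YI: "Y (Inl i) (Inr j) = y i j" "Y (Inl i) (Inl i') = 0" "Y (Inr j) (Inr j') = 0"
    "Y (Inr j) (Inl i) = (if i = j \<and> j \<in> {1..T} then \<Sum>k=0..T. y k j else 0)" for i i' j j'
    by (simp_all add: Y_def)
  \<comment> \<open>Between the two copies of a node only the throughput arc counts. Stated for
    arbitrary \<open>f\<close>, since it serves both \<open>Y\<close> and its part \<open>Z\<close>;
    likewise \<open>node_col\<close>.\<close>
  have node_row: "(\<Sum>i=0..T. f (Inr j) (Inl i)) = (if j \<in> {1..T} then f (Inr j) (Inl j) else 0)"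
    if "\<And>i. i \<in> {0..T} \<Longrightarrow> i \<noteq> j \<or> j \<notin> {1..T} \<Longrightarrow> f (Inr j) (Inl i) = 0"
    for f :: "nat + nat \<Rightarrow> nat + nat \<Rightarrow> real" and j
  proof -
    have "(\<Sum>i=0..T. f (Inr j) (Inl i)) = (\<Sum>i=0..T. if i = j then f (Inr j) (Inl j) else 0)"
      using that by (intro sum.cong) auto
    then show ?thesis using that by (auto simp: not_le)
  qed
  have node_col: "(\<Sum>j=1..T+1. f (Inr j) (Inl i)) = (if i \<in> {1..T} then f (Inr i) (Inl i) else 0)"
    if "\<And>j. j \<in> {1..T+1} \<Longrightarrow> i \<noteq> j \<or> j \<notin> {1..T} \<Longrightarrow> f (Inr j) (Inl i) = 0"
    for f :: "nat + nat \<Rightarrow> nat + nat \<Rightarrow> real" and i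
  proof -
    have "(\<Sum>j=1..T+1. f (Inr j) (Inl i)) = (\<Sum>j=1..T+1. if j = i then f (Inr i) (Inl i) else 0)"
      using that by (intro sum.cong) auto
    then show ?thesis using that[of i] by (auto simp: not_le)
  qed
  have "circulation V Y"
    unfolding circulation_def
  proof
    fix v assume "v \<in> V"
    then consider i where "v = Inl i" "i \<in> {0..T}" | j where "v = Inr j" "j \<in> {1..T+1}"
      by (cases v) (auto simp: mem)
    then show "(\<Sum>u\<in>V. Y v u) = (\<Sum>u\<in>V. Y u v)"
    proof cases
      case 1
      then show ?thesis
        using assms(1) assms(2)[of i] node_col[of i Y] by (cases "i = 0") (auto simp: sumV YI)
    next
      case 2
      then show ?thesis
        using sink node_row[of j Y] by (cases "j = T + 1") (auto simp: sumV YI)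
    qed
  qed
  moreover have "finite V" by (simp add: V_def)
  moreover have "Inl a \<in> V" "Inr b \<in> V" "Y (Inl a) (Inr b) \<ge> 0"
    using assms by (auto simp: mem YI)
  ultimately obtain Z where Z: "circulation V Z" "Z (Inl a) (Inr b) = Y (Inl a) (Inr b)"
    "\<And>u v. u \<in> V \<Longrightarrow> v \<in> V \<Longrightarrow> conformal (Z u v) (Y u v)"
    "\<And>v. v \<in> V \<Longrightarrow> v \<noteq> Inr b \<Longrightarrow> Y (Inl a) v > 0 \<Longrightarrow> Z (Inl a) v = 0"
    using conformal_subcirculation[of V Y "Inl a" "Inr b"] by blast
  have zero: "Z u v = 0" if "u \<in> V" "v \<in> V" "Y u v = 0" for u v
    using Z(3)[OF that(1,2)] that(3) by (auto simp: conformal_def)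
  have row: "(\<Sum>j=1..T+1. Z (Inl i) (Inr j)) = (if i \<in> {1..T} then Z (Inr i) (Inl i) else 0)"
    if "i \<in> {0..T}" for i
  proof -
    have "Inl i \<in> V" using that by (auto simp: mem)
    with Z(1) have "(\<Sum>u\<in>V. Z (Inl i) u) = (\<Sum>u\<in>V. Z u (Inl i))" by (auto simp: circulation_def)
    moreover have "(\<Sum>k=0..T. Z (Inl i) (Inl k)) = 0" "(\<Sum>k=0..T. Z (Inl k) (Inl i)) = 0"
      using that by (intro sum.neutral ballI zero; auto simp: mem YI)+
    moreover have "(\<Sum>j=1..T+1. Z (Inr j) (Inl i)) = (if i \<in> {1..T} then Z (Inr i) (Inl i) else 0)"
      using that by (intro node_col zero) (auto simp: mem YI)
    ultimately show ?thesis by (simp add: sumV)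
  qed
  have col: "(\<Sum>i=0..T. Z (Inl i) (Inr j)) = Z (Inr j) (Inl j)" if "j \<in> {1..T}" for j
  proof -
    have "Inr j \<in> V" using that by (auto simp: mem)
    with Z(1) have "(\<Sum>u\<in>V. Z (Inr j) u) = (\<Sum>u\<in>V. Z u (Inr j))" by (auto simp: circulation_def)
    moreover have "(\<Sum>k=1..T+1. Z (Inr j) (Inr k)) = 0" "(\<Sum>k=1..T+1. Z (Inr k) (Inr j)) = 0"
      using that by (intro sum.neutral ballI zero; auto simp: mem YI)+
    moreover have "(\<Sum>i=0..T. Z (Inr j) (Inl i)) = (if j \<in> {1..T} then Z (Inr j) (Inl j) else 0)"
      using that by (intro node_row zero) (auto simp: mem YI)
    ultimately show ?thesis using that by (simp add: sumV)
  qed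
  show ?thesis
  proof (rule that[of "\<lambda>i j. Z (Inl i) (Inr j)"])
    show "(\<Sum>j=1..T+1. Z (Inl 0) (Inr j)) = 0" using row[of 0] by simp
    show "(\<Sum>i=0..T. Z (Inl i) (Inr j)) = (\<Sum>k=1..T+1. Z (Inl j) (Inr k))" if "j \<in> {1..T}" for j
      using row[of j] col[of j] that by simp
    show "Z (Inl a) (Inr b) = y a b" using Z(2) by (simp add: YI)
    show "conformal (Z (Inl i) (Inr j)) (y i j)" if "i \<in> {0..T}" "j \<in> {1..T+1}" for i j
      using Z(3)[of "Inl i" "Inr j"] that by (auto simp: mem YI)
    \<comment> \<open>By \<open>col\<close> this sum is the entry of \<open>Z\<close> on the
      throughput arc of \<open>j\<close>.\<close>
    show "conformal (\<Sum>i=0..T. Z (Inl i) (Inr j)) (\<Sum>i=0..T. y i j)" if "j \<in> {1..T}" for j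
      using Z(3)[of "Inr j" "Inl j"] col[OF that] that by (auto simp: mem YI)
    show "Z (Inl a) (Inr j) = 0" if "j \<in> {1..T+1}" "j \<noteq> b" "y a j > 0" for j
      using Z(4)[of "Inr j"] that by (auto simp: mem YI)
  qed
qed

text \<open>Two factors with a fixed sum move closer together, so their product grows: concavity of
  the logarithm in multiplicative form.\<close>

lemma conformal_mult_le:
  assumes "f \<ge> 0" "g \<ge> 0" "conformal z (g - f)"
  shows "f * g \<le> (f + z) * (g - z)"
proof -
  have "z * (g - f - z) \<ge> 0"
    using assms(3) by (auto simp: conformal_def zero_le_mult_iff)
  then show ?thesis by (simp add: algebra_simps)
qed

text \<open>The part of \<open>x' - x\<close> that carries the terminal arc of \<open>s\<close>
  moves from \<open>x'\<close> to \<open>x\<close>. The total cost is linear and stays the same,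
  while at each node the product of the two throughputs does not decrease.\<close>

lemma flow_exchange:
  assumes x: "flow_on A T x" and x': "flow_on A' T x'"
    and A: "A \<subseteq> A'" "A' \<subseteq> A \<union> {s} \<times> UNIV" and s: "s \<in> {1..T}"
    and le: "x s (T+1) \<le> x' s (T+1)"
  obtains w w' where "flow_on A T w" "flow_on A' T w'" "w s (T+1) = x' s (T+1)"
    "payoff d lam T \<sigma> x * payoff d lam T \<sigma> x' \<le> payoff d lam T \<sigma> w * payoff d lam T \<sigma> w'"
proof -
  define y where "y i j = x' i j - x i j" for i j
  have "(\<Sum>j=1..T+1. y 0 j) = 0"
    using x x' by (simp add: y_def flow_on_def sum_subtractf)
  moreover have "(\<Sum>i=0..T. y i j) = (\<Sum>k=1..T+1. y j k)" if "j \<in> {1..T}" for j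
    using x x' that unfolding y_def flow_on_def sum_subtractf by simp
  moreover have "s \<in> {0..T}" "T + 1 \<in> {1..T+1}" "y s (T+1) \<ge> 0"
    using s le by (auto simp: y_def)
  ultimately obtain z where z: "(\<Sum>j=1..T+1. z 0 j) = 0"
    "\<And>j. j \<in> {1..T} \<Longrightarrow> (\<Sum>i=0..T. z i j) = (\<Sum>k=1..T+1. z j k)"
    "z s (T+1) = y s (T+1)"
    and conf: "\<And>i j. i \<in> {0..T} \<Longrightarrow> j \<in> {1..T+1} \<Longrightarrow> conformal (z i j) (y i j)"
    "\<And>j. j \<in> {1..T} \<Longrightarrow> conformal (\<Sum>i=0..T. z i j) (\<Sum>i=0..T. y i j)"
    and new: "\<And>j. j \<in> {1..T+1} \<Longrightarrow> j \<noteq> T + 1 \<Longrightarrow> y s j > 0 \<Longrightarrow> z s j = 0"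
    using circulation_of_flow_difference[of y T s "T+1"] by blast
  define w where "w i j = x i j + z i j" for i j
  define w' where "w' i j = x' i j - z i j" for i j
  have z0: "z i j = 0" if "i \<in> {0..T}" "j \<in> {1..T+1}" "y i j = 0" for i j
    using conf(1)[OF that(1,2)] that(3) by (auto simp: conformal_def)
  have src: "z 0 (T+1) = 0"
    using x x' by (intro z0) (auto simp: flow_on_def y_def)
  have nonneg: "w i j \<ge> 0" "w' i j \<ge> 0" if "i \<in> {0..T}" "j \<in> {1..T+1}" for i j
    using conf(1)[OF that] flow_on_nonneg[OF x that] flow_on_nonneg[OF x' that]
    by (auto simp: conformal_def y_def w_def w'_def)
  have zA': "z i j = 0" if "i \<in> {1..T}" "j \<in> {1..T}" "(i, j) \<notin> A'" for i j
  proof (rule z0)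
    have "x i j = 0" "x' i j = 0"
      using flow_on_zero[OF x that(1,2)] flow_on_zero[OF x' that(1,2)] that(3) A(1) by blast+
    then show "y i j = 0" by (simp add: y_def)
  qed (use that in auto)
  \<comment> \<open>On an arc of \<open>A'\<close> outside \<open>A\<close>, which must leave
    \<open>s\<close>, the flow \<open>x\<close> vanishes. So \<open>y\<close> is nonnegative there,
    and \<open>z\<close> vanishes by \<open>new\<close> if \<open>y\<close> is positive and by
    \<open>z0\<close> otherwise.\<close>
  have zA: "z i j = 0" if "i \<in> {1..T}" "j \<in> {1..T}" "(i, j) \<notin> A" for i j
  proof (cases "(i, j) \<in> A'")
    case True
    with A that have "i = s" by auto
    have "y i j \<ge> 0"
      using flow_on_zero[OF x that] flow_on_nonneg[OF x', of i j] that by (simp add: y_def)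
    then show ?thesis
      using new[of j] z0[of i j] that \<open>i = s\<close> by (cases "y i j = 0") auto
  qed (use zA' that in auto)
  have "flow_on A T w"
    unfolding flow_on_def
  proof (intro conjI ballI impI)
    show "w i j \<ge> 0" if "i \<in> {0..T}" "j \<in> {1..T+1}" for i j by (rule nonneg[OF that])
    show "(\<Sum>j=1..T. w 0 j) = 1" "w 0 (T+1) = 0"
      using x z(1) src by (simp_all add: w_def flow_on_def sum.distrib)
    show "(\<Sum>i=0..T. w i j) = (\<Sum>k=1..T+1. w j k)" if "j \<in> {1..T}" for j
      using x z(2)[OF that] that unfolding w_def flow_on_def sum.distrib by simp
    show "w i j = 0" if "i \<in> {1..T}" "j \<in> {1..T}" "(i, j) \<notin> A" for i j
      using flow_on_zero[OF x that] zA[OF that] by (simp add: w_def)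
  qed
  moreover have "flow_on A' T w'"
    unfolding flow_on_def
  proof (intro conjI ballI impI)
    show "w' i j \<ge> 0" if "i \<in> {0..T}" "j \<in> {1..T+1}" for i j by (rule nonneg[OF that])
    show "(\<Sum>j=1..T. w' 0 j) = 1" "w' 0 (T+1) = 0"
      using x' z(1) src by (simp_all add: w'_def flow_on_def sum_subtractf)
    show "(\<Sum>i=0..T. w' i j) = (\<Sum>k=1..T+1. w' j k)" if "j \<in> {1..T}" for j
      using x' z(2)[OF that] that unfolding w'_def flow_on_def sum_subtractf by simp
    show "w' i j = 0" if "i \<in> {1..T}" "j \<in> {1..T}" "(i, j) \<notin> A'" for i j
      using flow_on_zero[OF x' that] zA'[OF that] by (simp add: w'_def)
  qed
  moreover have "w s (T+1) = x' s (T+1)" using z(3) by (simp add: w_def y_def)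
  moreover have "payoff d lam T \<sigma> x * payoff d lam T \<sigma> x' \<le> payoff d lam T \<sigma> w * payoff d lam T \<sigma> w'"
  proof -
    define C where "C v = (\<Sum>j=1..T. \<Sum>i=1..T. d (\<sigma> i) (\<sigma> j) * v i j)" for v
    define F where "F v j = (\<Sum>i=0..T. v i j)" for v :: "nat \<Rightarrow> nat \<Rightarrow> real" and j
    have "C w = C x + C z" "C w' = C x' - C z"
      by (simp_all add: C_def w_def w'_def algebra_simps sum.distrib sum_subtractf)
    then have "lam * (C x + C x') = lam * (C w + C w')" by simp
    then have "- (lam * C x) + - (lam * C x') = - (lam * C w) + - (lam * C w')"
      unfolding distrib_left by linarith
    then have exps: "exp (- (lam * C x)) * exp (- (lam * C x')) = exp (- (lam * C w)) * exp (- (lam * C w'))"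
      by (simp only: exp_add[symmetric])
    have "(\<Prod>j=1..T. F x j * F x' j) \<le> (\<Prod>j=1..T. F w j * F w' j)"
    proof (rule prod_mono)
      fix j assume j: "j \<in> {1..T}"
      have nn: "F x j \<ge> 0" "F x' j \<ge> 0"
        using throughput_nonneg[OF x, of j] throughput_nonneg[OF x', of j] j by (auto simp: F_def)
      have "F w j = F x j + F z j" "F w' j = F x' j - F z j" "F y j = F x' j - F x j"
        by (simp_all add: F_def w_def w'_def y_def sum.distrib sum_subtractf)
      moreover have "conformal (F z j) (F y j)" using conf(2)[OF j] by (simp add: F_def)
      ultimately show "0 \<le> F x j * F x' j \<and> F x j * F x' j \<le> F w j * F w' j"
        using conformal_mult_le[of "F x j" "F x' j" "F z j"] nn by simp
    qed
    then have "prod (F x) {1..T} * prod (F x') {1..T} \<le> prod (F w) {1..T} * prod (F w') {1..T}"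
      by (simp add: prod.distrib)
    then have "(prod (F x) {1..T} * prod (F x') {1..T}) * (exp (- (lam * C x)) * exp (- (lam * C x')))
        \<le> (prod (F w) {1..T} * prod (F w') {1..T}) * (exp (- (lam * C w)) * exp (- (lam * C w')))"
      unfolding exps by (rule mult_right_mono) simp
    then show ?thesis by (simp add: payoff_def F_def C_def mult_ac)
  qed
  ultimately show ?thesis using that by blast
qed

section \<open>Existence of optimal solutions\<close>

text \<open>Time order makes the graph acyclic: node \<open>j\<close> receives at most 1 from the
  source and from each earlier node at most that node's throughput. Only some finite bound matters,
  for compactness and for suprema.\<close>

lemma feasible_throughput_le:
  assumes x: "feasible T x" and "j \<in> {1..T}"
  shows "(\<Sum>i=0..T. x i j) \<le> 2 ^ j"
  using assms(2)
proof (induction j rule: less_induct)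
  case (less j)
  have nn: "x i k \<ge> 0" if "i \<in> {0..T}" "k \<in> {1..T+1}" for i k
    using x that by (simp add: feasible_def)
  have "x 0 j \<le> (\<Sum>k=1..T. x 0 k)"
    using nn less.prems by (intro member_le_sum) auto
  then have "x 0 j \<le> 1" using x by (simp add: feasible_def)
  moreover have "x i j \<le> 2 ^ i" if "i \<in> {1..<j}" for i
  proof -
    have "x i j \<le> (\<Sum>k=1..T+1. x i k)"
      using nn that less.prems by (intro member_le_sum) auto
    also have "\<dots> = (\<Sum>k=0..T. x k i)"
      using x that less.prems by (simp add: feasible_def)
    also have "\<dots> \<le> 2 ^ i"
      using that less.prems by (intro less.IH) auto
    finally show ?thesis .
  qed
  \<comment> \<open>The source bound 1 is the case \<open>i = 0\<close>, so the inflow is bounded by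
    a geometric sum.\<close>
  ultimately have "x i j \<le> 2 ^ i" if "i \<in> {..<j}" for i
    using that by (cases "i = 0") auto
  then have "(\<Sum>i<j. x i j) \<le> (\<Sum>i<j. 2 ^ i)" by (intro sum_mono) auto
  also have "\<dots> \<le> 2 ^ j" by (induction j) auto
  finally have "(\<Sum>i<j. x i j) \<le> 2 ^ j" .
  moreover have "(\<Sum>i=0..T. x i j) = (\<Sum>i<j. x i j)"
    using x less.prems by (intro sum.mono_neutral_right) (auto simp: feasible_def)
  ultimately show ?case by simp
qed

lemma feasible_le:
  assumes x: "feasible T x" and "i \<in> {0..T}" "j \<in> {1..T+1}"
  shows "x i j \<le> 2 ^ T"
proof (cases "i = 0")
  case True
  have "x 0 j \<le> (\<Sum>k=1..T+1. x 0 k)"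
    using x assms(3) by (intro member_le_sum) (auto simp: feasible_def)
  then have "x 0 j \<le> 1" using x by (simp add: feasible_def)
  also have "(1::real) \<le> 2 ^ T" by simp
  finally show ?thesis using True by simp
next
  case False
  then have "x i j \<le> (\<Sum>k=1..T+1. x i k)"
    using x assms by (intro member_le_sum) (auto simp: feasible_def)
  also have "\<dots> = (\<Sum>k=0..T. x k i)"
    using x False assms(2) by (simp add: feasible_def)
  also have "\<dots> \<le> 2 ^ i"
    using x False assms(2) by (intro feasible_throughput_le) auto
  also have "\<dots> \<le> (2::real) ^ T" using assms(2) by (intro power_increasing) auto
  finally show ?thesis .
qed

text \<open>Tychonoff's theorem applied twice, once for each argument of the curried
  function.\<close>

lemma compact_box:
  fixes B :: "nat \<Rightarrow> nat \<Rightarrow> real set"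
  assumes "\<And>i j. compact (B i j)"
  shows "compact {x. \<forall>i j. x i j \<in> B i j}"
proof -
  have PiE: "compact (PiE UNIV K)" if "\<And>i. compact (K i)"
    for K :: "nat \<Rightarrow> ('b::topological_space) set"
    using that compactin_PiE[of "\<lambda>_. euclidean" "UNIV :: nat set" K]
    by (simp add: euclidean_product_topology)
  have "{x. \<forall>i j. x i j \<in> B i j} = PiE UNIV (\<lambda>i. PiE UNIV (B i))"
    by (auto simp: PiE_def Pi_def extensional_def)
  then show ?thesis using assms by (auto intro!: PiE)
qed

lemma continuous_on_entry: "continuous_on S (\<lambda>x :: nat \<Rightarrow> nat \<Rightarrow> real. x i j)"
proof -
  have "continuous_on UNIV ((\<lambda>g. g j) \<circ> (\<lambda>x :: nat \<Rightarrow> nat \<Rightarrow> real. x i))"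
    by (intro continuous_on_compose continuous_on_subset[OF continuous_on_product_coordinates]) auto
  then show ?thesis by (auto simp: o_def intro: continuous_on_subset)
qed

text \<open>Ensures that the supremum over the terminal values of \<open>\<sigma>'\<close> is taken
  over a nonempty set.\<close>

lemma optimal_exists:
  assumes "T \<ge> 1"
  obtains x where "optimal d lam T \<sigma> x"
proof -
  \<comment> \<open>Entries outside the index range are unconstrained, so the feasible set is not
    compact. Setting them to 0 affects neither feasibility nor payoff.\<close>
  define cut :: "(nat \<Rightarrow> nat \<Rightarrow> real) \<Rightarrow> nat \<Rightarrow> nat \<Rightarrow> real"
    where "cut x i j = (if i \<in> {0..T} \<and> j \<in> {1..T+1} then x i j else 0)" for x i j
  have feas_cut: "feasible T (cut x) \<longleftrightarrow> feasible T x" for x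
    by (simp add: feasible_def cut_def cong: sum.cong_simp)
  have payoff_cut: "payoff d lam T \<sigma> (cut x) = payoff d lam T \<sigma> x" for x
    by (simp add: payoff_def cut_def cong: sum.cong_simp prod.cong_simp)
  define K where "K = {x :: nat \<Rightarrow> nat \<Rightarrow> real. \<forall>i j. x i j \<in> {0..2 ^ T}} \<inter> {x. feasible T x}"
  have cutK: "cut x \<in> K" if "feasible T x" for x
    using that feas_cut feasible_le[OF that] by (auto simp: K_def cut_def feasible_def)
  have feas_split: "{x. feasible T x} =
     (\<Inter>i\<in>{0..T}. \<Inter>j\<in>{1..T+1}. {x. x i j \<ge> 0}) \<inter> {x. (\<Sum>j=1..T. x 0 j) = 1} \<inter>
     (\<Inter>j\<in>{1..T}. {x. (\<Sum>i=0..T. x i j) = (\<Sum>k=1..T+1. x j k)}) \<inter>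
     (\<Inter>i\<in>{1..T}. \<Inter>j\<in>{1..i}. {x. x i j = 0}) \<inter> {x. x 0 (T+1) = 0}"
    by (auto simp: feasible_def)
  have "closed {x. feasible T x}"
    unfolding feas_split
    by (intro closed_Int closed_INT ballI closed_Collect_le closed_Collect_eq continuous_on_sum
        continuous_on_const continuous_on_entry)
  then have "compact K"
    unfolding K_def by (intro compact_Int_closed compact_box) auto
  moreover have "K \<noteq> {}"
    using feasible_positive_payoff[OF assms] cutK by (metis empty_iff)
  moreover have "continuous_on K (payoff d lam T \<sigma>)"
    unfolding payoff_def
    by (intro continuous_on_mult continuous_on_prod continuous_on_sum continuous_on_exp
        continuous_on_minus continuous_on_const continuous_on_entry)
  ultimately obtain x where "x \<in> K" and x: "\<And>y. y \<in> K \<Longrightarrow> payoff d lam T \<sigma> y \<le> payoff d lam T \<sigma> x"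
    using continuous_attains_sup by metis
  then have "optimal d lam T \<sigma> x"
    using cutK payoff_cut unfolding optimal_iff_payoff K_def by (metis (no_types, lifting) IntD2 mem_Collect_eq)
  then show ?thesis by (rule that)
qed

section \<open>Terminal values and relabelling\<close>

text \<open>The supremum of a singleton is its element, so both branches agree and it suffices to
  compare sets of terminal values.\<close>

lemma terminal_prob_eq_Sup: "terminal_prob d lam T \<sigma> \<xi> = Sup (terminal_values d lam T \<sigma> \<xi>)"
proof (cases "\<exists>!p. p \<in> terminal_values d lam T \<sigma> \<xi>")
  case True
  then obtain p where "terminal_values d lam T \<sigma> \<xi> = {p}" by auto
  then show ?thesis by (simp add: terminal_prob_def)
next
  case False
  then show ?thesis unfolding terminal_prob_def by (rule if_not_P)
qed

lemma terminal_values_eq: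
  assumes "inj_on \<sigma> {1..T}" "s \<in> {1..T}"
  shows "terminal_values d lam T \<sigma> (\<sigma> s) = {x s (T+1) | x. optimal d lam T \<sigma> x}"
proof -
  have "(THE i. i \<in> {1..T} \<and> \<sigma> i = \<sigma> s) = s"
    using assms by (intro the_equality) (auto simp: inj_on_eq_iff)
  then show ?thesis by (simp add: terminal_values_def)
qed

text \<open>The position in \<open>\<sigma>'\<close> of the observation that \<open>\<sigma>\<close>
  has at time \<open>t\<close>: a cyclic permutation of \<open>s', ..., s\<close> that fixes source
  and sink.\<close>

definition shift :: "nat \<Rightarrow> nat \<Rightarrow> nat \<Rightarrow> nat" where
  "shift s' s t = (if t = s then s' else if s' \<le> t \<and> t < s then t + 1 else t)"

lemma move_earlier_shift: "s' < s \<Longrightarrow> move_earlier s' s \<sigma> (shift s' s t) = \<sigma> t"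
  by (auto simp: move_earlier_def shift_def)

lemma shift_inj: "s' < s \<Longrightarrow> inj (shift s' s)"
  by (auto simp: inj_def shift_def split: if_splits)

text \<open>Every arc gained by the move leaves \<open>s\<close>, as \<open>flow_exchange\<close>
  demands. The arcs lost, treated in \<open>shift_less_lost\<close>, are those that the component
  assumption shows to be idle.\<close>

lemma shift_less_new: "s' < s \<Longrightarrow> shift s' s i < shift s' s j \<Longrightarrow> i < j \<or> i = s"
  by (simp add: shift_def split: if_splits)

lemma shift_less_lost:
  "s' < s \<Longrightarrow> i < j \<Longrightarrow> shift s' s i < shift s' s j \<or> (j = s \<and> i \<in> {s'..<s})"
  by (simp add: shift_def split: if_splits)

text \<open>The loose bounds on \<open>a\<close> and \<open>b\<close> cover the index ranges with
  and without source or sink.\<close>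

lemma shift_image:
  assumes "1 \<le> s'" "s' < s" "s \<le> T"
  shows "a \<le> 1 \<Longrightarrow> b \<ge> T \<Longrightarrow> shift s' s ` {a..b} = {a..b}"
  using assms by (intro endo_inj_surj inj_on_subset[OF shift_inj[OF \<open>s' < s\<close>]]) (auto simp: shift_def)

lemma sum_shift:
  assumes "1 \<le> s'" "s' < s" "s \<le> T" "a \<le> 1" "b \<ge> T"
  shows "(\<Sum>i=a..b. f (shift s' s i)) = (\<Sum>i=a..b. f i)"
  using sum.reindex[OF inj_on_subset[OF shift_inj[OF \<open>s' < s\<close>]], of "{a..b}" f]
    shift_image[OF assms] by simp

text \<open>A permutation fixing source and sink preserves balance and sign constraints; the time
  order is carried along as the arc set.\<close>

lemma flow_on_shift:
  assumes s: "1 \<le> s'" "s' < s" "s \<le> T"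
  shows "flow_on {(i, j). shift s' s i < shift s' s j} T (\<lambda>i j. x (shift s' s i) (shift s' s j))
    \<longleftrightarrow> feasible T x"
proof -
  let ?\<rho> = "shift s' s"
  have all: "(\<forall>i\<in>{a..b}. P (?\<rho> i)) \<longleftrightarrow> (\<forall>i\<in>{a..b}. P i)" if "a \<le> 1" "b \<ge> T" for a b P
  proof -
    have "(\<forall>i\<in>{a..b}. P (?\<rho> i)) \<longleftrightarrow> (\<forall>i\<in>?\<rho> ` {a..b}. P i)" by simp
    then show ?thesis by (simp only: shift_image[OF s that])
  qed
  have all2: "(\<forall>i\<in>{a..b}. \<forall>j\<in>{a'..b'}. P (?\<rho> i) (?\<rho> j)) \<longleftrightarrow> (\<forall>i\<in>{a..b}. \<forall>j\<in>{a'..b'}. P i j)"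
    if "a \<le> 1" "b \<ge> T" "a' \<le> 1" "b' \<ge> T" for a b a' b' P
    unfolding all[OF that(1,2), of "\<lambda>i. \<forall>j\<in>{a'..b'}. P i (?\<rho> j)"]
    by (intro ball_cong refl all that)
  have ends: "?\<rho> 0 = 0" "?\<rho> (T+1) = T+1" using s by (auto simp: shift_def)
  have sums: "(\<Sum>i=1..T. f (?\<rho> i)) = (\<Sum>i=1..T. f i)" "(\<Sum>i=0..T. f (?\<rho> i)) = (\<Sum>i=0..T. f i)"
    "(\<Sum>i=1..T+1. f (?\<rho> i)) = (\<Sum>i=1..T+1. f i)" for f :: "nat \<Rightarrow> real"
    by (rule sum_shift[OF s]; simp)+
  have "(\<forall>i\<in>{0..T}. \<forall>j\<in>{1..T+1}. x (?\<rho> i) (?\<rho> j) \<ge> 0) \<longleftrightarrow>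
      (\<forall>i\<in>{0..T}. \<forall>j\<in>{1..T+1}. x i j \<ge> 0)"
    by (rule all2) auto
  moreover have "(\<Sum>j=1..T. x (?\<rho> 0) (?\<rho> j)) = (\<Sum>j=1..T. x 0 j)"
    using sums(1)[of "x 0"] by (simp add: ends(1))
  moreover have "(\<forall>j\<in>{1..T}. (\<Sum>i=0..T. x (?\<rho> i) (?\<rho> j)) = (\<Sum>k=1..T+1. x (?\<rho> j) (?\<rho> k))) \<longleftrightarrow>
      (\<forall>j\<in>{1..T}. (\<Sum>i=0..T. x i j) = (\<Sum>k=1..T+1. x j k))"
  proof -
    have "(\<Sum>i=0..T. x (?\<rho> i) j) = (\<Sum>i=0..T. x i j)" "(\<Sum>k=1..T+1. x j (?\<rho> k)) = (\<Sum>k=1..T+1. x j k)" for j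
      by (rule sums(2)[of "\<lambda>i. x i j"], rule sums(3)[of "x j"])
    then show ?thesis
      using all[of 1 T "\<lambda>j. (\<Sum>i=0..T. x i j) = (\<Sum>k=1..T+1. x j k)"] by simp
  qed
  moreover have "(\<forall>i\<in>{1..T}. \<forall>j\<in>{1..T}. (i, j) \<notin> {(i, j). ?\<rho> i < ?\<rho> j} \<longrightarrow> x (?\<rho> i) (?\<rho> j) = 0)
      \<longleftrightarrow> (\<forall>i\<in>{1..T}. \<forall>j\<in>{1..T}. (i, j) \<notin> {(i, j). i < j} \<longrightarrow> x i j = 0)"
    unfolding mem_Collect_eq prod.case by (rule all2) auto
  ultimately show ?thesis
    unfolding feasible_eq_flow_on flow_on_def by (simp only: ends)
qed

lemma payoff_shift:
  assumes s: "1 \<le> s'" "s' < s" "s \<le> T"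
  shows "payoff d lam T \<sigma> (\<lambda>i j. x (shift s' s i) (shift s' s j)) =
    payoff d lam T (move_earlier s' s \<sigma>) x"
proof -
  define \<rho> where "\<rho> = shift s' s"
  define \<tau> where "\<tau> = move_earlier s' s \<sigma>"
  have \<sigma>: "\<sigma> = (\<lambda>i. \<tau> (\<rho> i))"
    unfolding \<rho>_def \<tau>_def move_earlier_shift[OF s(2)] ..
  have reindex: "(\<Sum>i=a..b. f (\<rho> i)) = (\<Sum>i=a..b. f i)" if "a \<le> 1" "b \<ge> T"
    for a b and f :: "nat \<Rightarrow> real"
    unfolding \<rho>_def by (rule sum_shift[OF s that])
  have F: "(\<Sum>i=0..T. x (\<rho> i) j) = (\<Sum>i=0..T. x i j)" for j
    by (rule reindex[of 0 T "\<lambda>i. x i j"]) auto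
  have "(\<Prod>j=1..T. \<Sum>i=0..T. x i (\<rho> j)) = (\<Prod>j\<in>\<rho> ` {1..T}. \<Sum>i=0..T. x i j)"
    unfolding \<rho>_def by (subst prod.reindex[OF inj_on_subset[OF shift_inj[OF s(2)]]]) (auto simp only: o_def)
  also have "\<rho> ` {1..T} = {1..T}"
    unfolding \<rho>_def by (rule shift_image[OF s]) auto
  finally have P: "(\<Prod>j=1..T. \<Sum>i=0..T. x i (\<rho> j)) = (\<Prod>j=1..T. \<Sum>i=0..T. x i j)" .
  have C: "(\<Sum>i=1..T. d (\<tau> (\<rho> i)) v * x (\<rho> i) j) = (\<Sum>i=1..T. d (\<tau> i) v * x i j)" for v j
    by (rule reindex[of 1 T "\<lambda>i. d (\<tau> i) v * x i j"]) auto
  have "(\<Sum>j=1..T. \<Sum>i=1..T. d (\<tau> i) (\<tau> (\<rho> j)) * x i (\<rho> j)) =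
      (\<Sum>j=1..T. \<Sum>i=1..T. d (\<tau> i) (\<tau> j) * x i j)"
    by (rule reindex[of 1 T "\<lambda>j. \<Sum>i=1..T. d (\<tau> i) (\<tau> j) * x i j"]) auto
  then have "payoff d lam T (\<lambda>i. \<tau> (\<rho> i)) (\<lambda>i j. x (\<rho> i) (\<rho> j)) = payoff d lam T \<tau> x"
    unfolding payoff_def F C P by (rule arg_cong)
  then show ?thesis unfolding \<sigma>[symmetric] by (simp only: \<rho>_def \<tau>_def)
qed

section \<open>Domination of the terminal values of \<open>\<sigma>'\<close> by those of
  \<open>\<sigma>\<close>\<close>

theorem theorem2:
  fixes Xi :: "(real ^ 'm) set"
    and d :: "real ^ 'm \<Rightarrow> real ^ 'm \<Rightarrow> real"
    and T s s' :: nat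
    and \<xi> :: "nat \<Rightarrow> real ^ 'm"
    and \<sigma> \<sigma>' :: "nat \<Rightarrow> real ^ 'm"
    and lam :: real
  assumes "closed Xi"
    and "lsc_polish_metric Xi d"
    and "inj_on \<xi> {1..T}"
    and "\<xi> ` {1..T} \<subseteq> Xi"
    and "lam \<ge> 0"
    and "bij_betw \<sigma> {1..T} (\<xi> ` {1..T})"
    and "consecutive_dists_unique_sums d (\<xi> ` {1..T})"
    and "1 \<le> s'" and "s' < s" and "s \<le> T"
    and "\<sigma>' = move_earlier s' s \<sigma>"
    and "\<sigma> s = \<xi> s"
    and "\<exists>x. optimal d lam T \<sigma> x \<and> (\<forall>t\<in>{s'..<s}. \<not> same_component T x t s)"
  shows "terminal_prob d lam T \<sigma> (\<xi> s) \<ge> terminal_prob d lam T \<sigma>' (\<xi> s)"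
proof -
  note s = \<open>1 \<le> s'\<close> \<open>s' < s\<close> \<open>s \<le> T\<close>
  let ?\<rho> = "shift s' s"
  have sT: "s \<in> {1..T}" "s' \<in> {1..T}" "T \<ge> 1" using s by auto
  have \<sigma>': "\<sigma>' (?\<rho> t) = \<sigma> t" for t
    unfolding \<open>\<sigma>' = _\<close> by (rule move_earlier_shift[OF s(2)])
  have inj: "inj_on \<sigma> {1..T}" using \<open>bij_betw \<sigma> _ _\<close> by (rule bij_betw_imp_inj_on)
  have inj': "inj_on \<sigma>' {1..T}"
  proof -
    have "\<sigma>' \<circ> ?\<rho> = \<sigma>" by (rule ext) (simp only: o_apply \<sigma>')
    then have "inj_on \<sigma>' (?\<rho> ` {1..T})" using inj by (intro inj_on_imageI) (simp only:)
    moreover have "?\<rho> ` {1..T} = {1..T}" by (rule shift_image[OF s]) auto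
    ultimately show ?thesis by (simp only:)
  qed
  have \<rho>s: "?\<rho> s = s'" "?\<rho> (T+1) = T+1" using s by (auto simp: shift_def)
  \<comment> \<open>In the labels of \<open>\<sigma>\<close>, \<open>E'\<close> holds the arcs
    permitted by \<open>\<sigma>'\<close> and \<open>E\<close> those permitted by both sequences. A
    flow on \<open>E\<close> is feasible for \<open>\<sigma>\<close>.\<close>
  define E E' where "E = {(i, j). i < j} \<inter> {(i, j). ?\<rho> i < ?\<rho> j}"
    and "E' = {(i, j). ?\<rho> i < ?\<rho> j}"
  have E: "E \<subseteq> E'" "E' \<subseteq> E \<union> {s} \<times> UNIV" "E \<subseteq> {(i, j). i < j}"
    using shift_less_new[OF s(2)] by (auto simp: E_def E'_def)

  from assms(13) obtain x where x: "optimal d lam T \<sigma> x"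
    and comp: "\<And>t. t \<in> {s'..<s} \<Longrightarrow> \<not> same_component T x t s" by blast
  \<comment> \<open>Positive flow from \<open>t\<close> to \<open>s\<close> would join the two
    nodes.\<close>
  have x_block: "x t s = 0" if "t \<in> {s'..<s}" for t
  proof (rule ccontr)
    assume "x t s \<noteq> 0"
    moreover have "x t s \<ge> 0" using x that s by (simp add: optimal_def feasible_def)
    ultimately have "(t, s) \<in> joined T x" using that s by (auto simp: joined_def)
    then show False using comp[OF that] by (auto simp: same_component_def)
  qed
  have flow_x: "flow_on E T x"
  proof (rule flow_on_change_arcs)
    show "flow_on {(i, j). i < j} T x"
      using x by (simp add: optimal_def feasible_eq_flow_on)
    show "x i j = 0" if "(i, j) \<in> {(i, j). i < j}" "(i, j) \<notin> E" for i j
    proof -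
      have "j = s \<and> i \<in> {s'..<s}"
        using shift_less_lost[OF s(2), of i j] that by (auto simp: E_def)
      then show ?thesis using x_block by simp
    qed
  qed

  have transfer: "\<exists>w. optimal d lam T \<sigma> w \<and> y s' (T+1) \<le> w s (T+1)"
    if y: "optimal d lam T \<sigma>' y" for y
  \<comment> \<open>If the terminal value of \<open>y\<close> is no larger, \<open>x\<close> itself
    is the witness; otherwise flow is exchanged.\<close>
  proof (cases "y s' (T+1) \<le> x s (T+1)")
    case False
    let ?x' = "\<lambda>i j. y (?\<rho> i) (?\<rho> j)"
    have pay: "payoff d lam T \<sigma> (\<lambda>i j. v (?\<rho> i) (?\<rho> j)) = payoff d lam T \<sigma>' v" for v
      unfolding \<open>\<sigma>' = _\<close> by (rule payoff_shift[OF s])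
    have "flow_on E' T ?x'"
      unfolding E'_def flow_on_shift[OF s] using y by (simp add: optimal_def)
    moreover have "x s (T+1) \<le> ?x' s (T+1)" using False \<rho>s by simp
    ultimately obtain w w' where w: "flow_on E T w" "flow_on E' T w'" "w s (T+1) = y s' (T+1)"
      "payoff d lam T \<sigma> x * payoff d lam T \<sigma> ?x' \<le> payoff d lam T \<sigma> w * payoff d lam T \<sigma> w'"
      using flow_exchange[OF flow_x _ E(1,2) sT(1), where x' = ?x' and d = d and lam = lam and \<sigma> = \<sigma>] \<rho>s
      by metis
    \<comment> \<open>\<open>w'\<close> read in the positions of \<open>\<sigma>'\<close>, where
      optimality of \<open>y\<close> bounds its payoff.\<close>
    define v where "v i j = w' (inv ?\<rho> i) (inv ?\<rho> j)" for i j
    have w'v: "w' = (\<lambda>i j. v (?\<rho> i) (?\<rho> j))" by (simp add: v_def inv_f_f[OF shift_inj[OF s(2)]])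
    have "feasible T v" using w(2) unfolding w'v E'_def flow_on_shift[OF s] .
    then have "payoff d lam T \<sigma> w' \<le> payoff d lam T \<sigma> ?x'"
      using y unfolding w'v pay by (simp add: optimal_iff_payoff)
    with w(4) have "payoff d lam T \<sigma> x * payoff d lam T \<sigma> ?x' \<le> payoff d lam T \<sigma> w * payoff d lam T \<sigma> ?x'"
      using payoff_nonneg[OF w(1)] by (meson mult_left_mono order_trans)
    \<comment> \<open>Allows this factor to be cancelled, which makes \<open>w\<close> at least as
      good as \<open>x\<close>.\<close>
    moreover have "payoff d lam T \<sigma> ?x' > 0"
      unfolding pay using y feasible_positive_payoff[OF sT(3)] unfolding optimal_iff_payoff
      by (metis less_le_trans)
    ultimately have "payoff d lam T \<sigma> x \<le> payoff d lam T \<sigma> w" by simp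
    moreover have "feasible T w"
      unfolding feasible_eq_flow_on using w(1) by (rule flow_on_change_arcs) (use E(3) in blast)
    ultimately have "optimal d lam T \<sigma> w"
      using x unfolding optimal_iff_payoff by (meson order_trans)
    with w(3) show ?thesis by auto
  qed (use x in auto)

  have vals: "terminal_values d lam T \<sigma> (\<xi> s) = {x s (T+1) | x. optimal d lam T \<sigma> x}"
    using terminal_values_eq[OF inj sT(1)] \<open>\<sigma> s = \<xi> s\<close> by simp
  have vals': "terminal_values d lam T \<sigma>' (\<xi> s) = {y s' (T+1) | y. optimal d lam T \<sigma>' y}"
    using terminal_values_eq[OF inj' sT(2)] \<sigma>'[of s] \<rho>s \<open>\<sigma> s = \<xi> s\<close> by simp
  have "bdd_above (terminal_values d lam T \<sigma> (\<xi> s))"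
    unfolding vals using sT feasible_le[where T = T and i = s and j = "T+1"]
    by (intro bdd_aboveI[of _ "2 ^ T"]) (auto simp: optimal_def)
  moreover have "terminal_values d lam T \<sigma>' (\<xi> s) \<noteq> {}"
    unfolding vals' using optimal_exists[OF sT(3), of d lam \<sigma>'] by auto
  moreover have "\<exists>q\<in>terminal_values d lam T \<sigma> (\<xi> s). p \<le> q"
    if "p \<in> terminal_values d lam T \<sigma>' (\<xi> s)" for p
    using that transfer unfolding vals vals' by blast
  ultimately show ?thesis
    unfolding terminal_prob_eq_Sup by (intro cSup_mono)
qed

end
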